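(* Suppose the tensor $\mathcal{F}\in\mathrm{S}^3(\mathbb{C}^d)$, with $n=d-1$, has the decomposition $$\mathcal{F} = \lambda_1\begin{bmatrix}1\\ u_1\end{bmatrix}^{\otimes 3}+\cdots+\lambda_r\begin{bmatrix}1\\ u_r\end{bmatrix}^{\otimes 3}$$ for vectors $u_i\in\mathbb{C}^n$ and scalars $0\ne\lambda_i\in\mathbb{C}$. Let $v_i=(u_i)_{1:r}$ and $w_i=(u_i)_{r+1:n}$ for $i=1,\ldots,r$. Assume that the vectors $v_1,\ldots,v_r$ are linearly independent and that the vectors $w_1,\ldots,w_r$ are distinct from each other. Let $\xi$ be a generically chosen coefficient vector and let $p_1,\ldots,p_r$ be the vectors produced by the procedure described in the context. Then the tensor decomposition $$\mathcal{F}=p_1^{\otimes 3}+\cdots+p_r^{\otimes 3}$$ is unique.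
   Context: Notation. $[r]=\{1,\ldots,r\}$, $[r+1,n]=\{r+1,\ldots,n\}$. $\mathrm{S}^3(\mathbb{C}^d)$ is the space of third order symmetric tensors $(\mathcal{F}_{i_1i_2i_3})_{0\le i_1,i_2,i_3\le n}$, $n=d-1$ (tensor labels start at $0$; commas may separate labels). $\begin{bmatrix}1\\ u\end{bmatrix}$ is the vector with $0$th entry $1$ and $k$th entry $u_k$, $k=1,\dots,n$. For a vector $u$, $u_{a:b}=(u_a,\ldots,u_b)$. $\Omega$ is the set of labels $(i_1,i_2,i_3)$ with $i_1,i_2,i_3$ pairwise distinct; the procedure uses only the subtensor $\mathcal{F}_\Omega$. For a label set $J$, $\mathcal{F}_J$ is the subtensor of entries labelled by $J$, with norm the square root of the sum of squared moduli of its entries. $\sqrt[3]{\cdot}$ is the principal cube root. $^H$ denotes conjugate transpose. A property is generic if it holds in the whole space except a subset of zero Lebesgue measure. Uniqueness of a decomposition into cubes is understood up to scalings and permutations. Matrices. For $i\in[r]$, $j\in[r+1,n]$, $A_{ij}[\mathcal{F}]\in\mathbb{C}^{(n-r-1)\times r}$ and $b_{ij}[\mathcal{F}]\in\mathbb{C}^{n-r-1}$ have rows labelled by $l\in[r+1,n]\setminus\{j\}$, with $A_{ij}[\mathcal{F}]_{l,k}=\mathcal{F}_{0kl}$ ($k\in[r]$) and $b_{ij}[\mathcal{F}]_l=\mathcal{F}_{ijl}$. Procedure (from $\mathcal{F}_\Omega$, $r$ and $\xi=(\xi_{r+1},\ldots,\xi_n)$). 1. Determine $G$, whose columns $G(:,e_i+e_j)\in\mathbb{C}^r$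 ($i\in[r]$, $j\in[r+1,n]$) have entries $G(k,e_i+e_j)$, $k\in[r]$, by solving the linear systems $A_{ij}[\mathcal{F}]\,G(:,e_i+e_j)=b_{ij}[\mathcal{F}]$. 2. For $l\in[r+1,n]$ let $N_l(G)\in\mathbb{C}^{r\times r}$ be the matrix whose $(i,k)$ entry is $G(k,e_i+e_l)$, and let $N(\xi)=\xi_{r+1}N_{r+1}(G)+\cdots+\xi_nN_n(G)$. Let $\tilde v_1,\ldots,\tilde v_r$ be unit length eigenvectors of $N(\xi)$, and let $\tilde w_i=(\tilde v_i^HN_{r+1}(G)\tilde v_i,\ldots,\tilde v_i^HN_n(G)\tilde v_i)$ for $i=1,\ldots,r$. 3. Let $J_1=\{(0,i_1,i_2): i_1\in[r],\ i_2\in[r+1,n]\}$ and $J_2=\{(i_1,i_2,i_3): i_1\ne i_2,\ i_1,i_2\in[r],\ i_3\in[r+1,n]\}$. Let $(\beta_1^*,\ldots,\beta_r^* )$ be a minimizer of $\big\|\mathcal{F}_{J_1}-\sum_{k=1}^r\beta_k\,\tilde v_k\otimes\tilde w_k\big\|^2$ and $(\theta_1^*,\ldots,\theta_r^* )$ a minimizer of $\big\|\mathcal{F}_{J_2}-\sum_{k=1}^r\theta_k\,(\tilde v_k\otimes\tilde v_k\otimes\tilde w_k)_{J_2}\big\|^2$, where the entries of $\tilde v_k$ are labelled by $1,\ldots,r$ and those of $\tilde w_k$ by $r+1,\ldots,n$. Set $\hat\lambda_i=(\beta_i^* )^2/\theta_i^*$ and $\gamma_i=\theta_i^*/\beta_i^*$.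 4. Set $p_i=\sqrt[3]{\hat\lambda_i}\,(1,\gamma_i\tilde v_i,\tilde w_i)\in\mathbb{C}^d$ for $i=1,\ldots,r$.
   Formalization: The claim is proved for every run in which the linear systems for G and both least-squares problems have unique solutions (otherwise arbitrary choices, e.g. of θ when r=1, can give wrong p_i); without this, only that some run yields such p_i. *)

theory Defs
  imports "HOL-Analysis.Analysis"
begin

text \<open>
  The index types encode the label sets: \<open>'r\<close> stands for \<open>[r]\<close> (it also numbers the \<open>r\<close> summands),
  \<open>'s\<close> for \<open>[r+1,n]\<close>, \<open>'r + 's\<close> for \<open>[n]\<close>, and \<open>('r + 's) option\<close> for \<open>{0,...,n}\<close>, where \<open>None\<close>
  is the label \<open>0\<close>. So \<open>r = CARD('r)\<close>, \<open>n = CARD('r) + CARD('s)\<close> and \<open>d = n + 1\<close>; as types are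
  nonempty, \<open>r\<close> and \<open>n\<close> range over all pairs with \<open>1 \<le> r < n\<close>. The order of the labels plays no
  role beyond this splitting.
\<close>

type_synonym 'l tensor3 = "'l \<Rightarrow> 'l \<Rightarrow> 'l \<Rightarrow> complex"

abbreviation lab0 :: "('r + 's) option" where "lab0 \<equiv> None"
abbreviation labv :: "'r \<Rightarrow> ('r + 's) option" where "labv i \<equiv> Some (Inl i)"
abbreviation labw :: "'s \<Rightarrow> ('r + 's) option" where "labw j \<equiv> Some (Inr j)"

definition symmetric_tensor :: "'l tensor3 \<Rightarrow> bool" where
  "symmetric_tensor F \<longleftrightarrow> (\<forall>i j k. F i j k = F j i k \<and> F i j k = F i k j)"

definition cube :: "complex ^ 'l \<Rightarrow> 'l tensor3" where
  "cube p = (\<lambda>i j k. p $ i * p $ j * p $ k)"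

definition homog :: "complex ^ 'n \<Rightarrow> complex ^ ('n option)" where
  "homog u = (\<chi> a. case a of None \<Rightarrow> 1 | Some k \<Rightarrow> u $ k)"

definition vpart :: "complex ^ ('r::finite + 's::finite) \<Rightarrow> complex ^ 'r" where
  "vpart u = (\<chi> i. u $ Inl i)"

definition wpart :: "complex ^ ('r::finite + 's::finite) \<Rightarrow> complex ^ 's" where
  "wpart u = (\<chi> j. u $ Inr j)"

definition concat_vec :: "complex ^ 'r \<Rightarrow> complex ^ 's \<Rightarrow> complex ^ ('r::finite + 's::finite)" where
  "concat_vec v w = (\<chi> a. case a of Inl i \<Rightarrow> v $ i | Inr j \<Rightarrow> w $ j)"

definition independent_family :: "('i \<Rightarrow> complex ^ 'm) \<Rightarrow> bool" where
  "independent_family v \<longleftrightarrow> inj v \<and> vec.independent (range v)"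


subsection \<open>Decompositions into cubes\<close>

definition is_cube_decomposition :: "'l tensor3 \<Rightarrow> ('r::finite \<Rightarrow> complex ^ 'l) \<Rightarrow> bool" where
  "is_cube_decomposition F p \<longleftrightarrow> F = (\<lambda>a b c. \<Sum>i\<in>UNIV. cube (p i) a b c)"

text \<open>
  The admissible scalings are those by cube roots of unity, that is, those which leave the cube
  of a vector unchanged. Competing decompositions may contain zero vectors, so those
  with fewer than \<open>r\<close> cubes are covered as well.
\<close>

definition unique_cube_decomposition :: "'l tensor3 \<Rightarrow> ('r::finite \<Rightarrow> complex ^ 'l) \<Rightarrow> bool" where
  "unique_cube_decomposition F p \<longleftrightarrow>
     is_cube_decomposition F p \<and>
     (\<forall>q :: 'r \<Rightarrow> complex ^ 'l. is_cube_decomposition F q \<longrightarrow>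
        (\<exists>\<sigma> c. bij \<sigma> \<and> (\<forall>i. c i ^ 3 = 1 \<and> q i = c i *s p (\<sigma> i))))"


subsection \<open>The procedure\<close>

text \<open>
  \<open>G i j\<close> is the column \<open>G(:, e\<^sub>i + e\<^sub>j)\<close>. The equation with index \<open>l \<noteq> j\<close> is the row \<open>l\<close> of the
  linear system \<open>A\<^sub>i\<^sub>j[F] G(:, e\<^sub>i + e\<^sub>j) = b\<^sub>i\<^sub>j[F]\<close>.
\<close>

definition generating_system ::
    "('r::finite + 's::finite) option tensor3 \<Rightarrow> ('r \<Rightarrow> 's \<Rightarrow> complex ^ 'r) \<Rightarrow> bool" where
  "generating_system F G \<longleftrightarrow>
     (\<forall>i j l. l \<noteq> j \<longrightarrow>
        (\<Sum>k\<in>UNIV. F lab0 (labv k) (labw l) * G i j $ k) = F (labv i) (labw j) (labw l))"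

definition N_mat :: "('r::finite \<Rightarrow> 's::finite \<Rightarrow> complex ^ 'r) \<Rightarrow> 's \<Rightarrow> complex ^ 'r ^ 'r" where
  "N_mat G l = (\<chi> i k. G i l $ k)"

definition N_comb :: "('r::finite \<Rightarrow> 's::finite \<Rightarrow> complex ^ 'r) \<Rightarrow> complex ^ 's \<Rightarrow> complex ^ 'r ^ 'r" where
  "N_comb G \<xi> = (\<chi> i k. \<Sum>l\<in>UNIV. \<xi> $ l * N_mat G l $ i $ k)"

text \<open>
  ``Unit length eigenvectors \<open>v\<^sub>1, ..., v\<^sub>r\<close> of \<open>N\<close>'' means a full system of eigenvectors, i.e. a
  linearly independent one; repeating one eigenvector \<open>r\<close> times is not meant.
\<close>

definition unit_eigenvectors :: "complex ^ 'r ^ 'r \<Rightarrow> ('r::finite \<Rightarrow> complex ^ 'r) \<Rightarrow> bool" where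
  "unit_eigenvectors N V \<longleftrightarrow>
     independent_family V \<and> (\<forall>i. norm (V i) = 1 \<and> (\<exists>\<mu>. N *v V i = \<mu> *s V i))"

definition w_tilde ::
    "('r::finite \<Rightarrow> 's::finite \<Rightarrow> complex ^ 'r) \<Rightarrow> ('r \<Rightarrow> complex ^ 'r) \<Rightarrow> 'r \<Rightarrow> complex ^ 's" where
  "w_tilde G V i = (\<chi> l. \<Sum>a\<in>UNIV. cnj (V i $ a) * (N_mat G l *v V i) $ a)"

definition residual1 ::
    "('r::finite + 's::finite) option tensor3 \<Rightarrow> ('r \<Rightarrow> complex ^ 'r) \<Rightarrow> ('r \<Rightarrow> complex ^ 's)
       \<Rightarrow> complex ^ 'r \<Rightarrow> real" where
  "residual1 F V W \<beta> =
     (\<Sum>(a, b)\<in>UNIV. (cmod (F lab0 (labv a) (labw b) - (\<Sum>k\<in>UNIV. \<beta> $ k * V k $ a * W k $ b)))\<^sup>2)"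

definition residual2 ::
    "('r::finite + 's::finite) option tensor3 \<Rightarrow> ('r \<Rightarrow> complex ^ 'r) \<Rightarrow> ('r \<Rightarrow> complex ^ 's)
       \<Rightarrow> complex ^ 'r \<Rightarrow> real" where
  "residual2 F V W \<theta> =
     (\<Sum>(a, b, c)\<in>{(a, b, c). a \<noteq> b}.
        (cmod (F (labv a) (labv b) (labw c)
               - (\<Sum>k\<in>UNIV. \<theta> $ k * V k $ a * V k $ b * W k $ c)))\<^sup>2)"

text \<open>For complex \<open>z\<close>, \<open>z powr (1/3)\<close> is the principal cube root of \<open>z\<close> (and \<open>0\<close> for \<open>z = 0\<close>).\<close>

definition output_vectors ::
    "('r::finite \<Rightarrow> complex ^ 'r) \<Rightarrow> ('r \<Rightarrow> complex ^ 's::finite) \<Rightarrow> complex ^ 'r \<Rightarrow> complex ^ 'r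
       \<Rightarrow> 'r \<Rightarrow> complex ^ (('r + 's) option)" where
  "output_vectors V W \<beta> \<theta> i =
     (((\<beta> $ i)\<^sup>2 / \<theta> $ i) powr (1 / 3)) *s homog (concat_vec ((\<theta> $ i / \<beta> $ i) *s V i) (W i))"

text \<open>
  A run of the procedure on \<open>F\<close> and \<open>\<xi>\<close>: \<open>G\<close>, \<open>V\<close>, \<open>\<beta>\<close>, \<open>\<theta>\<close> are the solutions, eigenvectors and
  minimizers that were picked, \<open>p\<close> is the output. Only entries of \<open>F\<close> with pairwise distinct
  labels are accessed.
\<close>

definition procedure_run ::
    "('r::finite + 's::finite) option tensor3 \<Rightarrow> complex ^ 's \<Rightarrow> ('r \<Rightarrow> 's \<Rightarrow> complex ^ 'r)
       \<Rightarrow> ('r \<Rightarrow> complex ^ 'r) \<Rightarrow> complex ^ 'r \<Rightarrow> complex ^ 'r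
       \<Rightarrow> ('r \<Rightarrow> complex ^ (('r + 's) option)) \<Rightarrow> bool" where
  "procedure_run F \<xi> G V \<beta> \<theta> p \<longleftrightarrow>
     generating_system F G \<and>
     unit_eigenvectors (N_comb G \<xi>) V \<and>
     is_arg_min (residual1 F V (w_tilde G V)) (\<lambda>_. True) \<beta> \<and>
     is_arg_min (residual2 F V (w_tilde G V)) (\<lambda>_. True) \<theta> \<and>
     p = output_vectors V (w_tilde G V) \<beta> \<theta>"

text \<open>
  The linear systems and the least squares problems met in a run determine their solutions.
  This is not automatic: the matrices \<open>A\<^sub>i\<^sub>j[F]\<close> have full column rank only if the vectors \<open>w\<^sub>k\<close> with
  any one entry deleted are linearly independent, and \<open>\<theta>\<^sub>k\<close> does not influence \<open>residual2\<close> when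
  \<open>V k\<close> has a single nonzero entry. An arbitrary choice of solution may then give vectors \<open>p\<^sub>i\<close>
  whose cubes do not add up to \<open>F\<close>.
\<close>

definition run_determined ::
    "('r::finite + 's::finite) option tensor3 \<Rightarrow> ('r \<Rightarrow> 's \<Rightarrow> complex ^ 'r)
       \<Rightarrow> ('r \<Rightarrow> complex ^ 'r) \<Rightarrow> complex ^ 'r \<Rightarrow> complex ^ 'r \<Rightarrow> bool" where
  "run_determined F G V \<beta> \<theta> \<longleftrightarrow>
     (\<forall>G'. generating_system F G' \<longrightarrow> G' = G) \<and>
     (\<forall>\<beta>'. is_arg_min (residual1 F V (w_tilde G V)) (\<lambda>_. True) \<beta>' \<longrightarrow> \<beta>' = \<beta>) \<and>
     (\<forall>\<theta>'. is_arg_min (residual2 F V (w_tilde G V)) (\<lambda>_. True) \<theta>' \<longrightarrow> \<theta>' = \<theta>)"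

end

theory Submission
  imports Defs
begin

text \<open>
  The linear systems are solved by the \<open>G\<close> with \<open>v\<^sub>m\<^sup>T G(:, e\<^sub>i + e\<^sub>j) = (v\<^sub>m)\<^sub>i (w\<^sub>m)\<^sub>j\<close> for all \<open>m\<close>,
  and then \<open>N\<^sub>l v\<^sub>m = (w\<^sub>m)\<^sub>l v\<^sub>m\<close>. Off the finitely many null hyperplanes \<open>\<xi>\<^sup>T (w\<^sub>i - w\<^sub>j) = 0\<close> the
  eigenvalues \<open>\<xi>\<^sup>T w\<^sub>m\<close> of \<open>N(\<xi>)\<close> are distinct, so the computed eigenvectors are the \<open>v\<^sub>m\<close> up to order
  and scalars \<open>c\<^sub>i\<close>. Both least squares problems then have residual \<open>0\<close>, at \<open>\<beta>\<^sub>i = \<lambda>\<^sub>i / c\<^sub>i\<close> and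
  \<open>\<theta>\<^sub>i = \<lambda>\<^sub>i / c\<^sub>i\<^sup>2\<close>, from which the \<open>\<lambda>\<^sub>i\<close> and \<open>u\<^sub>i\<close> are read off. Uniqueness holds because the
  vectors \<open>p\<^sub>i\<close> are linearly independent.
\<close>

section \<open>Indexed linear independence and dual bases\<close>

text \<open>Two equal members would give a relation with coefficients 1 and -1, so the coefficient
  form also captures \<open>inj v\<close>; for injective families, sums over \<open>range v\<close>
  reindex to sums over the index type.\<close>

lemma independent_family_iff:
  fixes v :: "'i::finite \<Rightarrow> complex ^ 'm"
  shows "independent_family v \<longleftrightarrow> (\<forall>c. (\<Sum>i\<in>UNIV. c i *s v i) = 0 \<longrightarrow> (\<forall>i. c i = 0))"
proof
  assume ind: "independent_family v"
  then have inj: "inj v" and ir: "vec.independent (range v)"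
    by (auto simp: independent_family_def)
  show "\<forall>c. (\<Sum>i\<in>UNIV. c i *s v i) = 0 \<longrightarrow> (\<forall>i. c i = 0)"
  proof (intro allI impI)
    fix c i assume 0: "(\<Sum>i\<in>UNIV. c i *s v i) = 0"
    have "(\<Sum>x\<in>range v. c (inv v x) *s x) = (\<Sum>i\<in>UNIV. c i *s v i)"
      by (subst sum.reindex[OF inj]) (simp add: inj)
    with 0 have "c (inv v (v i)) = 0"
      using vec.independentD[OF ir, of "range v" "\<lambda>x. c (inv v x)" "v i"] by simp
    then show "c i = 0" by (simp add: inj)
  qed
next
  assume R: "\<forall>c. (\<Sum>i\<in>UNIV. c i *s v i) = 0 \<longrightarrow> (\<forall>i. c i = 0)"
  have inj: "inj v"
  proof (rule injI, rule ccontr)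
    fix i j assume e: "v i = v j" and n: "i \<noteq> j"
    define c where "c k = (if k = i then 1 else if k = j then - 1 else (0::complex))" for k
    have "(\<Sum>k\<in>UNIV. c k *s v k) = (\<Sum>k\<in>{i, j}. c k *s v k)"
      by (rule sum.mono_neutral_right) (auto simp: c_def)
    also have "\<dots> = 0" using e n by (simp add: c_def vec_eq_iff)
    finally have "c i = 0" using R by blast
    then show False by (simp add: c_def)
  qed
  have "vec.independent (range v)"
  proof (rule vec.independent_if_scalars_zero)
    fix f x assume 0: "(\<Sum>x\<in>range v. f x *s x) = 0" and "x \<in> range v"
    then obtain i where i: "x = v i" by blast
    have "(\<Sum>i\<in>UNIV. f (v i) *s v i) = 0"
      using 0 by (subst (asm) sum.reindex[OF inj]) simp
    then show "f x = 0" using R i by (metis (no_types))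
  qed simp
  with inj show "independent_family v" by (simp add: independent_family_def)
qed

lemma independent_familyD:
  fixes v :: "'i::finite \<Rightarrow> complex ^ 'm"
  assumes "independent_family v" "(\<Sum>i\<in>UNIV. c i *s v i) = 0"
  shows "c i = 0"
  using assms unfolding independent_family_iff by blast

lemma independent_family_scale:
  fixes v :: "'i::finite \<Rightarrow> complex ^ 'm"
  assumes ind: "independent_family v" and c: "\<And>i. c i \<noteq> 0"
  shows "independent_family (\<lambda>i. c i *s v i)"
  unfolding independent_family_iff
proof (intro allI impI)
  fix b i assume "(\<Sum>i\<in>UNIV. b i *s (c i *s v i)) = 0"
  then have "(\<Sum>i\<in>UNIV. (b i * c i) *s v i) = 0" by (simp add: vector_smult_assoc)
  then have "b i * c i = 0"
    using independent_familyD[OF ind, where c = "\<lambda>i. b i * c i"] by simp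
  with c show "b i = 0" by simp
qed

text \<open>The square matrix with rows \<open>v i\<close> has a two-sided inverse \<open>D\<close>.
  Its columns are the dual basis; the second identity expands arbitrary vectors in the basis
  \<open>v\<close>.\<close>

lemma independent_family_dual:
  fixes v :: "'r::finite \<Rightarrow> complex ^ 'r"
  assumes "independent_family v"
  obtains D :: "complex ^ 'r ^ 'r" where
    "\<And>i j. (\<Sum>a\<in>UNIV. v i $ a * D $ a $ j) = (if i = j then 1 else 0)"
    "\<And>a b. (\<Sum>i\<in>UNIV. D $ a $ i * v i $ b) = (if a = b then 1 else 0)"
proof -
  define A :: "complex ^ 'r ^ 'r" where "A = (\<chi> i. v i)"
  have "row i A = v i" for i by (simp add: row_def A_def vec_eq_iff)
  then obtain D where D: "A ** D = mat 1"
    using assms matrix_right_invertible_independent_rows[of A]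
    unfolding independent_family_iff by auto
  then have D': "D ** A = mat 1" by (simp add: matrix_left_right_inverse)
  show ?thesis
  proof
    show "(\<Sum>a\<in>UNIV. v i $ a * D $ a $ j) = (if i = j then 1 else 0)" for i j
      using arg_cong[OF D, of "\<lambda>M. M $ i $ j"] by (simp add: matrix_matrix_mult_def mat_def A_def)
    show "(\<Sum>i\<in>UNIV. D $ a $ i * v i $ b) = (if a = b then 1 else 0)" for a b
      using arg_cong[OF D', of "\<lambda>M. M $ a $ b"] by (simp add: matrix_matrix_mult_def mat_def A_def)
  qed
qed

section \<open>Uniqueness of sums of cubes of independent vectors\<close>

text \<open>
  Contracting with the dual functionals \<open>\<phi>\<^sub>j\<close> turns both decompositions into
  \<open>M\<^sup>T diag(q(x)) M = diag(p(x))\<close> for every coordinate \<open>x\<close>, where \<open>M\<^sub>m\<^sub>j = \<phi>\<^sub>j(q\<^sub>m)\<close>; contracting once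
  more with \<open>\<Sum>\<^sub>j \<phi>\<^sub>j\<close> gives \<open>M\<^sup>T diag(d) M = I\<close>, which makes \<open>M\<close> invertible.
\<close>

lemma unique_cube_decompositionI:
  fixes p :: "'r::finite \<Rightarrow> complex ^ 'l::finite" and \<phi> :: "'r \<Rightarrow> 'l \<Rightarrow> complex"
  assumes F: "is_cube_decomposition F p"
    and dual: "\<And>i j. (\<Sum>x\<in>UNIV. p i $ x * \<phi> j x) = (if i = j then 1 else 0)"
  shows "unique_cube_decomposition F p"
  unfolding unique_cube_decomposition_def
proof (intro conjI allI impI)
  fix q :: "'r \<Rightarrow> complex ^ 'l" assume q: "is_cube_decomposition F q"
  define M where "M m j = (\<Sum>x\<in>UNIV. q m $ x * \<phi> j x)" for m j
  define d where "d m = (\<Sum>j\<in>UNIV. M m j)" for m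
  have eq: "(\<Sum>m\<in>UNIV. q m $ a * q m $ b * q m $ x) = (\<Sum>m\<in>UNIV. p m $ a * p m $ b * p m $ x)" for a b x
    using fun_cong[OF fun_cong[OF fun_cong[OF
      trans[OF q[unfolded is_cube_decomposition_def, symmetric] F[unfolded is_cube_decomposition_def]],
        of a], of b], of x]
    by (simp add: cube_def)
  have contract: "(\<Sum>b\<in>UNIV. \<Sum>a\<in>UNIV. (\<Sum>m\<in>UNIV. r m $ a * r m $ b * r m $ x) * \<phi> j a * \<phi> k b)
      = (\<Sum>m\<in>UNIV. (\<Sum>a\<in>UNIV. r m $ a * \<phi> j a) * (\<Sum>b\<in>UNIV. r m $ b * \<phi> k b) * r m $ x)"
    for r :: "'r \<Rightarrow> complex ^ 'l" and j k x
  proof -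
    have "(\<Sum>b\<in>UNIV. \<Sum>a\<in>UNIV. (\<Sum>m\<in>UNIV. r m $ a * r m $ b * r m $ x) * \<phi> j a * \<phi> k b)
      = (\<Sum>b\<in>UNIV. \<Sum>m\<in>UNIV. \<Sum>a\<in>UNIV. r m $ a * r m $ b * r m $ x * \<phi> j a * \<phi> k b)"
      by (simp add: sum_distrib_right) (rule sum.cong[OF refl], rule sum.swap)
    also have "\<dots> = (\<Sum>m\<in>UNIV. \<Sum>b\<in>UNIV. \<Sum>a\<in>UNIV. r m $ a * r m $ b * r m $ x * \<phi> j a * \<phi> k b)"
      by (rule sum.swap)
    also have "\<dots> = (\<Sum>m\<in>UNIV. (\<Sum>b\<in>UNIV. \<Sum>a\<in>UNIV. (r m $ a * \<phi> j a) * (r m $ b * \<phi> k b)) * r m $ x)"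
      by (simp add: sum_distrib_left sum_distrib_right mult_ac)
    also have "\<dots> = (\<Sum>m\<in>UNIV. (\<Sum>a\<in>UNIV. r m $ a * \<phi> j a) * (\<Sum>b\<in>UNIV. r m $ b * \<phi> k b) * r m $ x)"
      by (subst sum.swap) (simp add: sum_product)
    finally show ?thesis .
  qed
  have MM: "(\<Sum>m\<in>UNIV. M m j * M m k * q m $ x) = (if j = k then p j $ x else 0)" for j k x
  proof -
    have "(\<Sum>m\<in>UNIV. M m j * M m k * q m $ x)
        = (\<Sum>m\<in>UNIV. (if m = j then 1 else 0) * (if m = k then 1 else 0) * p m $ x)"
      unfolding M_def contract[of q, symmetric] eq contract[of p] dual ..
    also have "\<dots> = (\<Sum>m\<in>UNIV. if m = j then (if j = k then p j $ x else 0) else 0)"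
      by (rule sum.cong) auto
    finally show ?thesis by simp
  qed
  have MMM: "(\<Sum>m\<in>UNIV. M m j * M m k * M m l) = (if j = k \<and> j = l then 1 else 0)" for j k l
  proof -
    have "(\<Sum>m\<in>UNIV. M m j * M m k * M m l)
        = (\<Sum>x\<in>UNIV. (\<Sum>m\<in>UNIV. M m j * M m k * q m $ x) * \<phi> l x)"
      unfolding M_def[of _ l] sum_distrib_left sum_distrib_right
      by (subst sum.swap) (simp add: mult_ac)
    then show ?thesis by (cases "j = k") (simp_all add: MM dual)
  qed
  have MMd: "(\<Sum>m\<in>UNIV. M m j * d m * M m k) = (if j = k then 1 else 0)" for j k
  proof -
    have "(\<Sum>m\<in>UNIV. M m j * d m * M m k) = (\<Sum>l\<in>UNIV. \<Sum>m\<in>UNIV. M m j * M m k * M m l)"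
      unfolding d_def sum_distrib_left sum_distrib_right
      by (subst sum.swap) (simp add: mult_ac)
    also have "\<dots> = (\<Sum>l\<in>UNIV. if l = j then (if j = k then 1 else 0) else 0)"
      unfolding MMM by (rule sum.cong) auto
    finally show ?thesis by simp
  qed
  define P :: "complex ^ 'r ^ 'r" where "P = (\<chi> j m. M m j * d m)"
  define Q :: "complex ^ 'r ^ 'r" where "Q = (\<chi> m j. M m j)"
  have "P ** Q = mat 1"
    by (simp add: P_def Q_def matrix_matrix_mult_def mat_def vec_eq_iff MMd)
  then have "Q ** P = mat 1" by (simp add: matrix_left_right_inverse)
  then have dMM: "(\<Sum>k\<in>UNIV. M m k * (M n k * d n)) = (if m = n then 1 else 0)" for m n
  proof -
    have "(\<Sum>k\<in>UNIV. M m k * (M n k * d n)) = (Q ** P) $ m $ n"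
      by (simp add: P_def Q_def matrix_matrix_mult_def)
    then show ?thesis by (simp add: \<open>Q ** P = mat 1\<close> mat_def)
  qed
  \<comment> \<open>Inserting the inverse of \<open>M\<close> into \<open>MM\<close> shows that
    \<open>q m\<close> is parallel to \<open>p j\<close> whenever \<open>M m j\<close> is
    nonzero.\<close>
  have key: "M m j * q m $ x = d m * M m j * p j $ x" for m j x
  proof -
    have "d m * M m j * p j $ x = (\<Sum>k\<in>UNIV. if k = j then d m * M m j * p j $ x else 0)"
      by simp
    also have "\<dots> = (\<Sum>k\<in>UNIV. d m * M m k * (if j = k then p j $ x else 0))"
      by (rule sum.cong) auto
    also have "\<dots> = (\<Sum>k\<in>UNIV. d m * M m k * (\<Sum>n\<in>UNIV. M n j * M n k * q n $ x))"
      unfolding MM ..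
    also have "\<dots> = (\<Sum>n\<in>UNIV. \<Sum>k\<in>UNIV. d m * M m k * (M n j * M n k * q n $ x))"
      unfolding sum_distrib_left by (rule sum.swap)
    also have "\<dots> = (\<Sum>n\<in>UNIV. M n j * q n $ x * (\<Sum>k\<in>UNIV. M n k * (M m k * d m)))"
      by (simp add: sum_distrib_left mult_ac)
    also have "\<dots> = (\<Sum>n\<in>UNIV. if n = m then M m j * q m $ x else 0)"
      unfolding dMM by (rule sum.cong) auto
    finally show ?thesis by auto
  qed
  have "\<exists>j. M m j \<noteq> 0" for m
    using dMM[of m m] by (auto intro: ccontr)
  then obtain \<sigma> where \<sigma>: "M m (\<sigma> m) \<noteq> 0" for m by metis
  have qp: "q m = d m *s p (\<sigma> m)" for m
    using key[of m "\<sigma> m"] \<sigma>[of m] by (simp add: vec_eq_iff mult.assoc mult.left_commute)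
  \<comment> \<open>By duality, putting \<open>qp\<close> back into the definition of
    \<open>M\<close> leaves a single possible nonzero entry in row \<open>m\<close>, at
    \<open>\<sigma> m\<close>.\<close>
  have M: "M m j = (if \<sigma> m = j then d m else 0)" for m j
  proof -
    have "M m j = d m * (\<Sum>x\<in>UNIV. p (\<sigma> m) $ x * \<phi> j x)"
      by (simp add: M_def qp sum_distrib_left mult_ac)
    then show ?thesis by (simp add: dual)
  qed
  \<comment> \<open>An index missed by \<open>\<sigma>\<close> would give a zero column of
    \<open>M\<close>, whereas \<open>MMM\<close> says that the cubes in each column add up to
    1.\<close>
  have "surj \<sigma>"
  proof (rule ccontr)
    assume "\<not> surj \<sigma>"
    then obtain j where "\<And>m. \<sigma> m \<noteq> j" unfolding surj_def by metis
    then show False using MMM[of j j j] by (simp add: M)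
  qed
  then have bij: "bij \<sigma>" by (simp add: bij_def finite_UNIV_surj_inj)
  \<comment> \<open>Column \<open>\<sigma> m\<close> has the single nonzero entry
    \<open>d m\<close>, so \<open>MMM\<close> reduces to its cube.\<close>
  have "d m ^ 3 = 1" for m
  proof -
    have "(\<Sum>n\<in>UNIV. M n (\<sigma> m) * M n (\<sigma> m) * M n (\<sigma> m))
        = (\<Sum>n\<in>UNIV. if n = m then d m ^ 3 else 0)"
      using bij by (intro sum.cong) (auto simp: M power3_eq_cube bij_def inj_eq)
    then show ?thesis by (simp add: MMM)
  qed
  then show "\<exists>\<sigma> c. bij \<sigma> \<and> (\<forall>i. c i ^ 3 = 1 \<and> q i = c i *s p (\<sigma> i))"
    using bij qp by blast
qed (rule F)

section \<open>Eigenvectors for distinct eigenvalues\<close>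

text \<open>Expanding \<open>x\<close> in the eigenbasis and comparing coefficients gives
  \<open>c m * (\<mu> m - \<nu>) = 0\<close>. As the \<open>\<mu> m\<close> are distinct, only one
  coefficient can survive.\<close>

lemma eigenvector_simple_spectrum:
  fixes N :: "complex ^ 'r ^ 'r" and v :: "'r::finite \<Rightarrow> complex ^ 'r"
  assumes ind: "independent_family v"
    and N: "\<And>m. N *v v m = \<mu> m *s v m" and inj: "inj \<mu>"
    and x: "N *v x = \<nu> *s x" "x \<noteq> 0"
  shows "\<exists>m c. c \<noteq> 0 \<and> x = c *s v m"
proof -
  obtain D :: "complex ^ 'r ^ 'r" where
    D: "\<And>a b. (\<Sum>i\<in>UNIV. D $ a $ i * v i $ b) = (if a = b then 1 else 0)"
    using independent_family_dual[OF ind] by metis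
  define c where "c m = (\<Sum>a\<in>UNIV. x $ a * D $ a $ m)" for m
  have xc: "x = (\<Sum>m\<in>UNIV. c m *s v m)"
  proof -
    have "(\<Sum>m\<in>UNIV. c m * v m $ b) = x $ b" for b
    proof -
      have "(\<Sum>m\<in>UNIV. c m * v m $ b) = (\<Sum>a\<in>UNIV. x $ a * (\<Sum>m\<in>UNIV. D $ a $ m * v m $ b))"
        unfolding c_def sum_distrib_left sum_distrib_right
        by (subst sum.swap) (simp add: mult_ac)
      then show ?thesis unfolding D by (simp add: mult_delta_right)
    qed
    then show ?thesis by (simp add: vec_eq_iff)
  qed
  have "N *v x = (\<Sum>m\<in>UNIV. (c m * \<mu> m) *s v m)"
    unfolding xc by (simp add: linear_sum vec.sum vector_scalar_commute N vector_smult_assoc)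
  moreover have "\<nu> *s x = (\<Sum>m\<in>UNIV. (\<nu> * c m) *s v m)"
    unfolding xc by (simp add: vec_eq_iff sum_distrib_left mult_ac)
  ultimately have "(\<Sum>m\<in>UNIV. (c m * (\<mu> m - \<nu>)) *s v m) = 0"
    using x(1) by (simp add: vec_eq_iff algebra_simps sum_subtractf)
  then have z: "c m * (\<mu> m - \<nu>) = 0" for m
    using independent_familyD[OF ind, where c = "\<lambda>m. c m * (\<mu> m - \<nu>)"] by simp
  have "\<exists>m. c m \<noteq> 0"
  proof (rule ccontr)
    assume "\<nexists>m. c m \<noteq> 0"
    then have "x = 0" by (subst xc) simp
    with x(2) show False ..
  qed
  then obtain m where m: "c m \<noteq> 0" ..
  have "c k = 0" if "k \<noteq> m" for k
    using z[of k] z[of m] m inj that by (auto simp: inj_eq)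
  then have "x = (\<Sum>k\<in>UNIV. if k = m then c m *s v m else 0)"
    by (subst xc) (rule sum.cong, auto)
  then have "x = c m *s v m" by simp
  with m show ?thesis by blast
qed


section \<open>Weighted cubes in block coordinates and the generating matrices\<close>

lemma sum_UNIV_option_sum:
  fixes f :: "('r::finite + 's::finite) option \<Rightarrow> 'a::comm_monoid_add"
  shows "(\<Sum>x\<in>UNIV. f x) = f lab0 + (\<Sum>i\<in>UNIV. f (labv i)) + (\<Sum>j\<in>UNIV. f (labw j))"
proof -
  have "(\<Sum>x\<in>UNIV. f x) = f None + (\<Sum>x\<in>UNIV. f (Some x))"
    by (simp add: UNIV_option_conv sum.reindex)
  also have "(\<Sum>x\<in>UNIV. f (Some x)) = (\<Sum>x\<in>(UNIV :: 'r set) <+> (UNIV :: 's set). f (Some x))"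
    by simp
  also have "\<dots> = (\<Sum>i\<in>UNIV. f (labv i)) + (\<Sum>j\<in>UNIV. f (labw j))"
    by (subst sum.Plus) (simp_all add: o_def)
  finally show ?thesis by (simp add: add.assoc)
qed

lemma homog_simps [simp]:
  "homog u $ lab0 = 1" "homog u $ labv i = vpart u $ i" "homog u $ labw j = wpart u $ j"
  by (simp_all add: homog_def vpart_def wpart_def)

lemma concat_vec_parts: "concat_vec (vpart u) (wpart u) = u"
  by (simp add: concat_vec_def vpart_def wpart_def vec_eq_iff split: sum.split)

text \<open>Any choice of cube roots \<open>s i\<close> absorbs the weights. Independence of the
  \<open>vpart\<close> blocks supplies dual functionals supported on the labels
  \<open>labv\<close>.\<close>

lemma unique_cube_decomposition_weighted:
  fixes u :: "'r::finite \<Rightarrow> complex ^ ('r + 's::finite)"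
  assumes F: "F = (\<lambda>a b c. \<Sum>i\<in>UNIV. lam i * cube (homog (u i)) a b c)"
    and lam: "\<And>i. lam i \<noteq> 0"
    and ind: "independent_family (\<lambda>i. vpart (u i))"
    and bij: "bij (\<sigma> :: 'r \<Rightarrow> 'r)" and s: "\<And>i. s i ^ 3 = lam (\<sigma> i)"
  shows "unique_cube_decomposition F (\<lambda>i. s i *s homog (u (\<sigma> i)))"
proof -
  obtain D :: "complex ^ 'r ^ 'r" where
    D: "\<And>i j. (\<Sum>a\<in>UNIV. vpart (u i) $ a * D $ a $ j) = (if i = j then 1 else 0)"
    using independent_family_dual[OF ind] by metis
  have s0: "s i \<noteq> 0" for i using s[of i] lam[of "\<sigma> i"] by auto
  \<comment> \<open>Dividing by \<open>s j\<close> compensates the scaling of the vectors, and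
    column \<open>\<sigma> j\<close> of \<open>D\<close> follows their reordering.\<close>
  define \<phi> :: "'r \<Rightarrow> ('r + 's) option \<Rightarrow> complex"
    where "\<phi> j x = (case x of Some (Inl a) \<Rightarrow> D $ a $ \<sigma> j / s j | _ \<Rightarrow> 0)" for j x
  show ?thesis
  proof (rule unique_cube_decompositionI)
    have "F a b c = (\<Sum>i\<in>UNIV. cube (s i *s homog (u (\<sigma> i))) a b c)" for a b c
    proof -
      have "F a b c = (\<Sum>i\<in>UNIV. lam (\<sigma> i) * cube (homog (u (\<sigma> i))) a b c)"
        unfolding F by (rule sum.reindex_bij_betw[OF bij, symmetric])
      then show ?thesis by (simp add: s[symmetric] cube_def power3_eq_cube mult_ac)
    qed
    then show "is_cube_decomposition F (\<lambda>i. s i *s homog (u (\<sigma> i)))"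
      by (simp add: is_cube_decomposition_def fun_eq_iff)
    show "(\<Sum>x\<in>UNIV. (s i *s homog (u (\<sigma> i))) $ x * \<phi> j x) = (if i = j then 1 else 0)" for i j
    proof -
      have "(\<Sum>x\<in>UNIV. (s i *s homog (u (\<sigma> i))) $ x * \<phi> j x)
          = s i / s j * (\<Sum>a\<in>UNIV. vpart (u (\<sigma> i)) $ a * D $ a $ \<sigma> j)"
        by (simp add: sum_UNIV_option_sum \<phi>_def sum_distrib_left mult.assoc)
      then show ?thesis using s0 bij by (simp add: D bij_def inj_eq)
    qed
  qed
qed

text \<open>The identity \<open>G\<close> proved below has two readings: as row \<open>i\<close> of
  the eigenvector equation for \<open>N_mat G j\<close>, and, summed over \<open>m\<close> with
  weights \<open>lam m * wpart (u m) $ l\<close>, as the linear equation with index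
  \<open>l\<close>.\<close>

lemma generating_system_exists:
  fixes u :: "'r::finite \<Rightarrow> complex ^ ('r + 's::finite)"
  assumes F: "F = (\<lambda>a b c. \<Sum>i\<in>UNIV. lam i * cube (homog (u i)) a b c)"
    and ind: "independent_family (\<lambda>i. vpart (u i))"
  obtains G where "generating_system F G"
    and "\<And>l m. N_mat G l *v vpart (u m) = wpart (u m) $ l *s vpart (u m)"
proof -
  obtain D :: "complex ^ 'r ^ 'r" where
    D: "\<And>i j. (\<Sum>a\<in>UNIV. vpart (u i) $ a * D $ a $ j) = (if i = j then 1 else 0)"
    using independent_family_dual[OF ind] by metis
  define G :: "'r \<Rightarrow> 's \<Rightarrow> complex ^ 'r"
    where "G i j = (\<chi> k. \<Sum>m\<in>UNIV. D $ k $ m * (vpart (u m) $ i * wpart (u m) $ j))" for i j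
  have G: "(\<Sum>k\<in>UNIV. vpart (u m) $ k * G i j $ k) = vpart (u m) $ i * wpart (u m) $ j" for m i j
  proof -
    have "(\<Sum>k\<in>UNIV. vpart (u m) $ k * G i j $ k)
        = (\<Sum>n\<in>UNIV. (\<Sum>k\<in>UNIV. vpart (u m) $ k * D $ k $ n) * (vpart (u n) $ i * wpart (u n) $ j))"
      unfolding G_def vec_lambda_beta sum_distrib_left sum_distrib_right
      by (subst sum.swap) (simp add: mult_ac)
    then show ?thesis unfolding D by (simp add: mult_delta_left)
  qed
  show ?thesis
  proof
    show "N_mat G l *v vpart (u m) = wpart (u m) $ l *s vpart (u m)" for l m
      using G[of m _ l] by (simp add: N_mat_def matrix_vector_mult_def vec_eq_iff mult_ac)
    have "(\<Sum>k\<in>UNIV. F lab0 (labv k) (labw l) * G i j $ k) = F (labv i) (labw j) (labw l)" for i j l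
    proof -
      have "(\<Sum>k\<in>UNIV. F lab0 (labv k) (labw l) * G i j $ k)
          = (\<Sum>m\<in>UNIV. lam m * wpart (u m) $ l * (\<Sum>k\<in>UNIV. vpart (u m) $ k * G i j $ k))"
        unfolding F cube_def sum_distrib_left sum_distrib_right
        by (subst sum.swap) (simp add: mult_ac)
      then show ?thesis unfolding G F cube_def by (simp add: mult_ac)
    qed
    then show "generating_system F G" by (simp add: generating_system_def)
  qed
qed

section \<open>Exact least squares solutions and the resulting output\<close>

lemma sum_cnj_self: "norm (x :: complex ^ 'n) = 1 \<Longrightarrow> (\<Sum>a\<in>UNIV. cnj (x $ a) * x $ a) = 1"
proof -
  assume "norm x = 1"
  then have "(\<Sum>a\<in>UNIV. (cmod (x $ a))\<^sup>2) = 1"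
    by (simp add: norm_vec_def L2_set_def)
  then have "complex_of_real (\<Sum>a\<in>UNIV. (cmod (x $ a))\<^sup>2) = 1" by simp
  then show ?thesis by (simp add: complex_norm_square mult.commute del: of_real_power)
qed

lemma residual_nonneg: "0 \<le> residual1 F V W \<beta>" "0 \<le> residual2 F V W \<theta>"
  unfolding residual1_def residual2_def by (auto intro!: sum_nonneg)

text \<open>This serves both an arbitrary determined run and the construction of one: once the
  eigenvectors are multiples of the \<open>vpart\<close> vectors, the remaining steps of the
  procedure recover the decomposition.\<close>

lemma run_from_scaled_vectors:
  fixes u :: "'r::finite \<Rightarrow> complex ^ ('r + 's::finite)"
  assumes F: "F = (\<lambda>a b c. \<Sum>i\<in>UNIV. lam i * cube (homog (u i)) a b c)"
    and lam: "\<And>i. lam i \<noteq> 0"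
    and ind: "independent_family (\<lambda>i. vpart (u i))"
    and G: "\<And>l m. N_mat G l *v vpart (u m) = wpart (u m) $ l *s vpart (u m)"
    and bij: "bij (\<sigma> :: 'r \<Rightarrow> 'r)" and c: "\<And>i. c i \<noteq> 0"
    and V: "\<And>i. V i = c i *s vpart (u (\<sigma> i))" "\<And>i. norm (V i) = 1"
  defines "\<beta> \<equiv> (\<chi> i. lam (\<sigma> i) / c i)" and "\<theta> \<equiv> (\<chi> i. lam (\<sigma> i) / (c i)\<^sup>2)"
  shows "is_arg_min (residual1 F V (w_tilde G V)) (\<lambda>_. True) \<beta>"
    and "is_arg_min (residual2 F V (w_tilde G V)) (\<lambda>_. True) \<theta>"
    and "unique_cube_decomposition F (output_vectors V (w_tilde G V) \<beta> \<theta>)"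
proof -
  \<comment> \<open>\<open>w_tilde\<close> is a Rayleigh quotient, so on a unit eigenvector it
    returns the eigenvalue, whatever \<open>c i\<close> is.\<close>
  have W: "w_tilde G V i = wpart (u (\<sigma> i))" for i
  proof -
    have "N_mat G l *v V i = wpart (u (\<sigma> i)) $ l *s V i" for l
      unfolding V by (simp add: vector_scalar_commute G vector_smult_assoc mult.commute)
    then have "w_tilde G V i $ l = wpart (u (\<sigma> i)) $ l * (\<Sum>a\<in>UNIV. cnj (V i $ a) * V i $ a)" for l
      by (simp add: w_tilde_def sum_distrib_left mult_ac)
    then show ?thesis by (simp add: sum_cnj_self V(2) vec_eq_iff)
  qed
  have Fs: "F x y z = (\<Sum>i\<in>UNIV. lam (\<sigma> i) * cube (homog (u (\<sigma> i))) x y z)" for x y z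
    unfolding F by (rule sum.reindex_bij_betw[OF bij, symmetric])
  \<comment> \<open>The entries are linear in the \<open>vpart\<close> factor here and quadratic in
    \<open>residual2\<close>, hence one and two divisions by \<open>c i\<close>. A zero residual is
    minimal because residuals are nonnegative.\<close>
  have "residual1 F V (w_tilde G V) \<beta> = 0"
    unfolding residual1_def W Fs \<beta>_def V cube_def using c
    by (simp add: field_simps)
  then show "is_arg_min (residual1 F V (w_tilde G V)) (\<lambda>_. True) \<beta>"
    by (simp add: is_arg_min_def not_less residual_nonneg)
  have "residual2 F V (w_tilde G V) \<theta> = 0"
    unfolding residual2_def W Fs \<theta>_def V cube_def using c
    by (auto simp add: field_simps power2_eq_square intro!: sum.neutral)
  then show "is_arg_min (residual2 F V (w_tilde G V)) (\<lambda>_. True) \<theta>"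
    by (simp add: is_arg_min_def not_less residual_nonneg)
  define s where "s i = lam (\<sigma> i) powr (1 / 3)" for i
  have s: "s i ^ 3 = lam (\<sigma> i)" for i
  proof -
    have "s i ^ 3 = s i * s i * s i" by (simp add: power3_eq_cube)
    also have "\<dots> = lam (\<sigma> i) powr (1 / 3 + 1 / 3 + 1 / 3)"
      unfolding s_def by (simp only: powr_add)
    finally show ?thesis using lam by simp
  qed
  have "output_vectors V (w_tilde G V) \<beta> \<theta> i = s i *s homog (u (\<sigma> i))" for i
  proof -
    \<comment> \<open>The scalars cancel in the first ratio; the second is the factor that undoes
      the normalisation of \<open>V i\<close>.\<close>
    have "(\<beta> $ i)\<^sup>2 / \<theta> $ i = lam (\<sigma> i)" and "\<theta> $ i / \<beta> $ i = 1 / c i"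
      using c[of i] lam[of "\<sigma> i"] by (simp_all add: \<beta>_def \<theta>_def power2_eq_square)
    moreover have "(1 / c i) *s V i = vpart (u (\<sigma> i))"
      using c[of i] by (simp add: V(1) vector_smult_assoc)
    ultimately show ?thesis
      by (simp only: output_vectors_def s_def W concat_vec_parts)
  qed
  then have "output_vectors V (w_tilde G V) \<beta> \<theta> = (\<lambda>i. s i *s homog (u (\<sigma> i)))" by blast
  then show "unique_cube_decomposition F (output_vectors V (w_tilde G V) \<beta> \<theta>)"
    using unique_cube_decomposition_weighted[OF F lam ind bij s] by simp
qed

section \<open>Generic coefficient vectors and the runs they give\<close>

text \<open>The zero set lies in the zero set of the real part, which is a real hyperplane with
  normal vector the conjugate of \<open>d\<close>, hence null.\<close>

lemma AE_complex_linear_form_nonzero: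
  fixes d :: "complex ^ 'n"
  assumes "d \<noteq> 0"
  shows "AE \<xi> in lebesgue. (\<Sum>l\<in>UNIV. \<xi> $ l * d $ l) \<noteq> 0"
proof -
  define a where "a = (\<chi> l. cnj (d $ l))"
  have "Re (\<Sum>l\<in>UNIV. \<xi> $ l * d $ l) = a \<bullet> \<xi>" for \<xi>
    by (simp add: a_def inner_vec_def inner_complex_def mult.commute)
  then have sub: "{\<xi>. (\<Sum>l\<in>UNIV. \<xi> $ l * d $ l) = 0} \<subseteq> {\<xi>. a \<bullet> \<xi> = 0}"
    by (metis (mono_tags, lifting) Collect_mono zero_complex.simps(1))
  have "a \<noteq> 0" using assms by (auto simp: a_def vec_eq_iff)
  then have "{\<xi>. a \<bullet> \<xi> = 0} \<in> null_sets lebesgue"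
    using negligible_hyperplane negligible_iff_null_sets by blast
  then show ?thesis by (rule AE_I') (use sub in auto)
qed

lemma N_comb_mult_vec: "N_comb G \<xi> *v x = (\<Sum>l\<in>UNIV. \<xi> $ l *s (N_mat G l *v x))"
proof -
  have "(N_comb G \<xi> *v x) $ i = (\<Sum>l\<in>UNIV. \<xi> $ l * (N_mat G l *v x) $ i)" for i
    unfolding N_comb_def matrix_vector_mult_def vec_lambda_beta sum_distrib_left sum_distrib_right
    by (subst sum.swap) (simp add: mult_ac)
  then show ?thesis by (simp add: vec_eq_iff)
qed

theorem theorem3p3:
  fixes F :: "('r::finite + 's::finite) option tensor3"
    and lam :: "'r \<Rightarrow> complex"
    and u :: "'r \<Rightarrow> complex ^ ('r + 's)"
  assumes "symmetric_tensor F"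
    and "F = (\<lambda>a b c. \<Sum>i\<in>UNIV. lam i * cube (homog (u i)) a b c)"
    and "\<And>i. lam i \<noteq> 0"
    and "independent_family (\<lambda>i. vpart (u i))"
    and "inj (\<lambda>i. wpart (u i))"
  shows "AE \<xi> in lebesgue.
           (\<forall>G V \<beta> \<theta> p. procedure_run F \<xi> G V \<beta> \<theta> p \<and> run_determined F G V \<beta> \<theta>
              \<longrightarrow> unique_cube_decomposition F p) \<and>
           (\<exists>G V \<beta> \<theta> p. procedure_run F \<xi> G V \<beta> \<theta> p \<and> unique_cube_decomposition F p)"
proof -
  note F = assms(2) and lam = assms(3) and ind = assms(4)
  define \<mu> where "\<mu> \<xi> m = (\<Sum>l\<in>UNIV. \<xi> $ l * wpart (u m) $ l)" for \<xi> m
  obtain G0 where gen: "generating_system F G0"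
    and G0: "\<And>l m. N_mat G0 l *v vpart (u m) = wpart (u m) $ l *s vpart (u m)"
    using generating_system_exists[OF F ind] by metis
  have eig: "N_comb G0 \<xi> *v vpart (u m) = \<mu> \<xi> m *s vpart (u m)" for \<xi> m
    by (simp add: N_comb_mult_vec G0 \<mu>_def vec_eq_iff sum_distrib_left sum_distrib_right mult_ac)
  have "AE \<xi> in lebesgue. i \<noteq> j \<longrightarrow> \<mu> \<xi> i \<noteq> \<mu> \<xi> j" for i j
  proof (cases "i = j")
    case False
    with assms(5) have "wpart (u i) - wpart (u j) \<noteq> 0" by (auto dest: injD)
    from AE_complex_linear_form_nonzero[OF this] show ?thesis
      by eventually_elim (simp add: \<mu>_def algebra_simps sum_subtractf)
  qed simp
  then have "AE \<xi> in lebesgue. \<forall>ij\<in>UNIV. fst ij \<noteq> snd ij \<longrightarrow> \<mu> \<xi> (fst ij) \<noteq> \<mu> \<xi> (snd ij)"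
    by (intro AE_finite_allI) auto
  then have generic: "AE \<xi> in lebesgue. inj (\<mu> \<xi>)"
    by eventually_elim (auto simp: inj_def)
  have determined: "unique_cube_decomposition F p"
    if inj: "inj (\<mu> \<xi>)" and run: "procedure_run F \<xi> G V \<beta> \<theta> p" and det: "run_determined F G V \<beta> \<theta>"
    for \<xi> G V \<beta> \<theta> p
  proof -
    \<comment> \<open>Determinacy identifies the computed solution with the explicit one, whose
      eigenvectors are known.\<close>
    have G: "G = G0" using det gen by (simp add: run_determined_def)
    from run have Vind: "independent_family V" and Vn: "\<And>i. norm (V i) = 1"
      and Ve: "\<And>i. \<exists>\<nu>. N_comb G0 \<xi> *v V i = \<nu> *s V i"
      and p: "p = output_vectors V (w_tilde G0 V) \<beta> \<theta>"
      by (auto simp: procedure_run_def unit_eigenvectors_def G)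
    have "\<exists>m c. c \<noteq> 0 \<and> V i = c *s vpart (u m)" for i
    proof -
      have "V i \<noteq> 0" using Vn[of i] by auto
      then show ?thesis
        using eigenvector_simple_spectrum[OF ind eig inj] Ve[of i] by blast
    qed
    then obtain \<sigma> c where c: "\<And>i. c i \<noteq> 0" and V: "\<And>i. V i = c i *s vpart (u (\<sigma> i))"
      by metis
    \<comment> \<open>Two multiples of the same vector would be dependent, contrary to the
      independence of \<open>V\<close>.\<close>
    have "inj \<sigma>"
    proof (rule injI, rule ccontr)
      fix i j assume e: "\<sigma> i = \<sigma> j" and n: "i \<noteq> j"
      define b where "b k = (if k = i then 1 / c i else if k = j then - 1 / c j else 0)" for k
      have "(\<Sum>k\<in>UNIV. b k *s V k) = (\<Sum>k\<in>{i, j}. b k *s V k)"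
        by (rule sum.mono_neutral_right) (auto simp: b_def)
      also have "\<dots> = 0" using e n c by (simp add: b_def V vector_smult_assoc vec_eq_iff)
      finally have "b i = 0" by (rule independent_familyD[OF Vind])
      then show False using c by (simp add: b_def)
    qed
    then have bij: "bij \<sigma>" by (simp add: bij_def finite_UNIV_inj_surj)
    \<comment> \<open>The explicit coefficients are minimizers, so determinacy forces
      \<open>\<beta>\<close> and \<open>\<theta>\<close> to be these.\<close>
    note run' = run_from_scaled_vectors[OF F lam ind G0 bij c V Vn]
    show ?thesis
      using run' det unfolding p run_determined_def G by metis
  qed
  have existence: "\<exists>G V \<beta> \<theta> p. procedure_run F \<xi> G V \<beta> \<theta> p \<and> unique_cube_decomposition F p" for \<xi>
  proof -
    have nz: "vpart (u i) \<noteq> 0" for i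
    proof
      assume "vpart (u i) = 0"
      then have "(\<Sum>k\<in>UNIV. (if k = i then 1 else 0) *s vpart (u k)) = 0"
        by (intro sum.neutral) (simp add: vec_eq_iff)
      then have "(if i = i then 1 else 0 :: complex) = 0"
        by (rule independent_familyD[OF ind])
      then show False by simp
    qed
    \<comment> \<open>Each \<open>vpart (u i)\<close> is an eigenvector of
      \<open>N_comb G0 \<xi>\<close> for every \<open>\<xi>\<close>; normalising these vectors gives
      a run with \<open>\<sigma> = id\<close>.\<close>
    define c where "c i = complex_of_real (1 / norm (vpart (u i)))" for i
    define V where "V i = c i *s vpart (u i)" for i
    have c: "c i \<noteq> 0" for i using nz by (simp add: c_def)
    have Vn: "norm (V i) = 1" for i
    proof -
      have "V i = (1 / norm (vpart (u i))) *\<^sub>R vpart (u i)"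
        by (simp add: V_def c_def vec_eq_iff scaleR_conv_of_real[where 'a = complex])
      then show ?thesis using nz by simp
    qed
    have Vind: "independent_family V"
      using independent_family_scale[OF ind c] by (simp add: V_def[abs_def])
    have "N_comb G0 \<xi> *v V i = \<mu> \<xi> i *s V i" for i
      by (simp add: V_def vector_scalar_commute eig vector_smult_assoc mult.commute)
    then have "unit_eigenvectors (N_comb G0 \<xi>) V"
      using Vind Vn by (auto simp: unit_eigenvectors_def)
    moreover have "V i = c i *s vpart (u (id i))" for i by (simp add: V_def)
    note run_from_scaled_vectors[OF F lam ind G0 bij_id c this Vn]
    ultimately show ?thesis
      unfolding procedure_run_def using gen by blast
  qed
  show ?thesis
    using generic by eventually_elim (use determined existence in blast)
qed

end
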